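(* Let $\pi_A,\pi_B$ be $\mathbb{N}^\infty$-interpretations with universes $A,B$ (possibly infinite), let $\bar a\in A^n$, $\bar b\in B^n$, and let $k\ge1$, $m\in\mathbb{N}$. If there is a formula $\varphi(\bar x)$ of quantifier rank at most $m$ with $\pi_A[\![\varphi(\bar a)]\!]\ne\pi_B[\![\varphi(\bar b)]\!]$ such that $\pi_A[\![\varphi(\bar a)]\!]<k$ or $\pi_B[\![\varphi(\bar b)]\!]<k$, then Spoiler has a winning strategy in $G_{km}(\pi_A,\bar a,\pi_B,\bar b)$.
   Context: $\mathbb{N}^\infty=(\mathbb{N}\cup\{\infty\},+,\cdot,0,1)$ extends the natural numbers by $\infty$ with $s+\infty=\infty$, $s\cdot\infty=\infty$ for $s\ne0$ and $0\cdot\infty=0$. For a finite relational vocabulary $\tau$ and universe $A$, an $\mathbb{N}^\infty$-interpretation is a map $\pi$ from the literals $R\bar a,\neg R\bar a$ ($R\in\tau$, $\bar a$ from $A$) to $\mathbb{N}^\infty$. First-order formulae in negation normal form are evaluated with equalities/inequalities by truth value ($1$/$0$), literals by $\pi$, $\vee,\exists$ by sums, $\wedge,\forall$ by products over the universe; infinite sums and infinite products are defined as the suprema of the finite partial sums, resp. finite subproducts. The game $G_k(\pi_A,\bar a,\pi_B,\bar b)$: in each of $k$ rounds Spoiler picks an element of $A$ or $B$ and Duplicator one of the other universe; Duplicator wins iff the final map from the extended $A$-tuple to the extended $B$-tuple is a local isomorphism (same equality pattern and $\pi_A(L(\bar a'))=\pi_B(L(\bar b'))$ for all $\tau$-literals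 $L$).
   Formalization: Infinite products are taken to be 0 when some factor is 0, and the supremum of the finite subproducts otherwise; with the plain supremum the claim fails when comparing a finite with an infinite universe. Universes are assumed nonempty. *)

theory Defs
  imports Main "HOL-Library.Extended_Nat"
begin

text \<open>
  The semiring of natural numbers with infinity is the library type \<^typ>\<open>enat\<close>; its
  multiplication satisfies \<open>0 * \<infinity> = 0\<close>.
\<close>

definition nsum :: "('i \<Rightarrow> enat) \<Rightarrow> 'i set \<Rightarrow> enat" where
  "nsum f I = (SUP F \<in> {F. finite F \<and> F \<subseteq> I}. sum f F)"

text \<open>
  A subproduct that omits a factor 0 may exceed the full product, and the empty subproduct is 1,
  so the plain supremum would give the wrong value for families with a factor 0, even finite ones.
  As in any semiring, such a product is 0; the supremum is used when all factors are nonzero.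
  The lemma \<open>nprod_finite\<close> confirms that finite products are the ordinary ones.
\<close>

definition nprod :: "('i \<Rightarrow> enat) \<Rightarrow> 'i set \<Rightarrow> enat" where
  "nprod f I =
     (if \<exists>i\<in>I. f i = 0 then 0 else (SUP F \<in> {F. finite F \<and> F \<subseteq> I}. prod f F))"

lemma nsum_finite:
  assumes "finite I"
  shows "nsum f I = sum f I"
  unfolding nsum_def
proof (rule antisym)
  show "(SUP F \<in> {F. finite F \<and> F \<subseteq> I}. sum f F) \<le> sum f I"
    by (rule SUP_least) (auto intro: sum_mono2 assms)
  show "sum f I \<le> (SUP F \<in> {F. finite F \<and> F \<subseteq> I}. sum f F)"
    by (rule SUP_upper) (use assms in auto)
qed

lemma nprod_finite:
  assumes "finite I"
  shows "nprod f I = prod f I"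
proof (cases "\<exists>i\<in>I. f i = 0")
  case True
  then obtain i where "i \<in> I" "f i = 0" by blast
  then have "prod f I = 0" using assms by (simp add: prod.remove)
  then show ?thesis using True by (simp add: nprod_def)
next
  case False
  have ge1: "1 \<le> f i" if "i \<in> I" for i
    using False that by (metis ileI1 not_gr_zero one_eSuc)
  have "prod f F \<le> prod f I" if "F \<subseteq> I" for F
  proof -
    have "1 \<le> prod f (I - F)"
      using ge1 by (intro prod_ge_1) auto
    then have "1 * prod f F \<le> prod f (I - F) * prod f F"
      by (rule mult_right_mono) simp
    also have "\<dots> = prod f I"
      using prod.subset_diff[OF that assms, of f] by simp
    finally show ?thesis by simp
  qed
  then have "(SUP F \<in> {F. finite F \<and> F \<subseteq> I}. prod f F) = prod f I"
    by (intro antisym SUP_least SUP_upper) (use assms in auto)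
  then show ?thesis using False by (auto simp: nprod_def)
qed

text \<open>
  Relational literals \<open>R x\<^sub>1 \<dots> x\<^sub>r\<close> and \<open>\<not> R x\<^sub>1 \<dots> x\<^sub>r\<close>, with entries that are variables in
  formulae and elements of the universe in interpretations. A vocabulary is a set \<open>\<tau>\<close> of
  relation symbols together with an arity function \<open>ar\<close>.
\<close>

datatype (dead 'r, 'x) lit = Pos 'r "'x list" | Neg 'r "'x list"

fun wf_lit :: "'r set \<Rightarrow> ('r \<Rightarrow> nat) \<Rightarrow> ('r, 'x) lit \<Rightarrow> bool" where
  "wf_lit \<tau> ar (Pos R xs) \<longleftrightarrow> R \<in> \<tau> \<and> length xs = ar R"
| "wf_lit \<tau> ar (Neg R xs) \<longleftrightarrow> R \<in> \<tau> \<and> length xs = ar R"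

text \<open>
  An interpretation assigns arbitrary, mutually unrelated values to \<open>R a\<close> and \<open>\<not> R a\<close>. Its values
  on literals that are not over \<open>\<tau>\<close> and the universe are never used.
\<close>

type_synonym ('r, 'a) interp = "('r, 'a) lit \<Rightarrow> enat"

text \<open>First-order formulae in negation normal form, with variables named by natural numbers.\<close>

datatype 'r fml =
    Eq nat nat
  | Neq nat nat
  | Lit "('r, nat) lit"
  | Or "'r fml" "'r fml"
  | And "'r fml" "'r fml"
  | Ex nat "'r fml"
  | All nat "'r fml"

fun wf_fml :: "'r set \<Rightarrow> ('r \<Rightarrow> nat) \<Rightarrow> 'r fml \<Rightarrow> bool" where
  "wf_fml \<tau> ar (Eq x y) \<longleftrightarrow> True"
| "wf_fml \<tau> ar (Neq x y) \<longleftrightarrow> True"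
| "wf_fml \<tau> ar (Lit L) \<longleftrightarrow> wf_lit \<tau> ar L"
| "wf_fml \<tau> ar (Or \<phi> \<psi>) \<longleftrightarrow> wf_fml \<tau> ar \<phi> \<and> wf_fml \<tau> ar \<psi>"
| "wf_fml \<tau> ar (And \<phi> \<psi>) \<longleftrightarrow> wf_fml \<tau> ar \<phi> \<and> wf_fml \<tau> ar \<psi>"
| "wf_fml \<tau> ar (Ex x \<phi>) \<longleftrightarrow> wf_fml \<tau> ar \<phi>"
| "wf_fml \<tau> ar (All x \<phi>) \<longleftrightarrow> wf_fml \<tau> ar \<phi>"

fun fv :: "'r fml \<Rightarrow> nat set" where
  "fv (Eq x y) = {x, y}"
| "fv (Neq x y) = {x, y}"
| "fv (Lit L) = set_lit L"
| "fv (Or \<phi> \<psi>) = fv \<phi> \<union> fv \<psi>"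
| "fv (And \<phi> \<psi>) = fv \<phi> \<union> fv \<psi>"
| "fv (Ex x \<phi>) = fv \<phi> - {x}"
| "fv (All x \<phi>) = fv \<phi> - {x}"

fun qr :: "'r fml \<Rightarrow> nat" where
  "qr (Eq x y) = 0"
| "qr (Neq x y) = 0"
| "qr (Lit L) = 0"
| "qr (Or \<phi> \<psi>) = max (qr \<phi>) (qr \<psi>)"
| "qr (And \<phi> \<psi>) = max (qr \<phi>) (qr \<psi>)"
| "qr (Ex x \<phi>) = Suc (qr \<phi>)"
| "qr (All x \<phi>) = Suc (qr \<phi>)"

fun eval :: "'a set \<Rightarrow> ('r, 'a) interp \<Rightarrow> (nat \<Rightarrow> 'a) \<Rightarrow> 'r fml \<Rightarrow> enat" where
  "eval A \<pi> s (Eq x y) = (if s x = s y then 1 else 0)"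
| "eval A \<pi> s (Neq x y) = (if s x \<noteq> s y then 1 else 0)"
| "eval A \<pi> s (Lit L) = \<pi> (map_lit s L)"
| "eval A \<pi> s (Or \<phi> \<psi>) = eval A \<pi> s \<phi> + eval A \<pi> s \<psi>"
| "eval A \<pi> s (And \<phi> \<psi>) = eval A \<pi> s \<phi> * eval A \<pi> s \<psi>"
| "eval A \<pi> s (Ex x \<phi>) = nsum (\<lambda>c. eval A \<pi> (s(x := c)) \<phi>) A"
| "eval A \<pi> s (All x \<phi>) = nprod (\<lambda>c. eval A \<pi> (s(x := c)) \<phi>) A"

text \<open>The assignment \<open>xs ! i \<mapsto> as ! i\<close>; it is arbitrary on variables outside \<open>xs\<close>.\<close>

definition assign :: "nat list \<Rightarrow> 'a list \<Rightarrow> nat \<Rightarrow> 'a" where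
  "assign xs as x = the (map_of (zip xs as) x)"

text \<open>
  The map \<open>as ! i \<mapsto> bs ! i\<close> is a local isomorphism. A literal over the elements of \<open>as\<close> is given
  by a literal \<open>L\<close> over the positions \<open>i < length as\<close>.
\<close>

definition local_iso ::
  "'r set \<Rightarrow> ('r \<Rightarrow> nat) \<Rightarrow> ('r, 'a) interp \<Rightarrow> 'a list \<Rightarrow> ('r, 'b) interp \<Rightarrow> 'b list \<Rightarrow> bool" where
  "local_iso \<tau> ar \<pi>\<^sub>A as \<pi>\<^sub>B bs \<longleftrightarrow>
     length as = length bs \<and>
     (\<forall>i < length as. \<forall>j < length as. as ! i = as ! j \<longleftrightarrow> bs ! i = bs ! j) \<and>
     (\<forall>L. wf_lit \<tau> ar L \<longrightarrow> set_lit L \<subseteq> {..<length as} \<longrightarrow>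
        \<pi>\<^sub>A (map_lit ((!) as) L) = \<pi>\<^sub>B (map_lit ((!) bs) L))"

text \<open>
  A strategy for Spoiler maps each position, i.e. the two tuples extended by the elements chosen
  so far, to a move: \<open>Inl c\<close> picks \<open>c\<close> in \<open>A\<close> and \<open>Inr d\<close> picks \<open>d\<close> in \<open>B\<close>.
  \<open>play A B \<sigma> as bs j as' bs'\<close> holds iff \<open>(as', bs')\<close> can be reached after \<open>j\<close> rounds when Spoiler
  follows \<open>\<sigma>\<close> from \<open>(as, bs)\<close>.
\<close>

type_synonym ('a, 'b) strategy = "'a list \<Rightarrow> 'b list \<Rightarrow> 'a + 'b"

inductive play ::
  "'a set \<Rightarrow> 'b set \<Rightarrow> ('a, 'b) strategy \<Rightarrow> 'a list \<Rightarrow> 'b list \<Rightarrow> nat \<Rightarrow> 'a list \<Rightarrow> 'b list \<Rightarrow> bool"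
  for A B \<sigma> as bs where
  start: "play A B \<sigma> as bs 0 as bs"
| pick_A: "play A B \<sigma> as bs j as' bs' \<Longrightarrow> \<sigma> as' bs' = Inl c \<Longrightarrow> d \<in> B \<Longrightarrow>
             play A B \<sigma> as bs (Suc j) (as' @ [c]) (bs' @ [d])"
| pick_B: "play A B \<sigma> as bs j as' bs' \<Longrightarrow> \<sigma> as' bs' = Inr d \<Longrightarrow> c \<in> A \<Longrightarrow>
             play A B \<sigma> as bs (Suc j) (as' @ [c]) (bs' @ [d])"

definition spoiler_wins ::
  "'r set \<Rightarrow> ('r \<Rightarrow> nat) \<Rightarrow> 'a set \<Rightarrow> 'b set \<Rightarrow> nat \<Rightarrow>
   ('r, 'a) interp \<Rightarrow> 'a list \<Rightarrow> ('r, 'b) interp \<Rightarrow> 'b list \<Rightarrow> bool" where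
  "spoiler_wins \<tau> ar A B k \<pi>\<^sub>A as \<pi>\<^sub>B bs \<longleftrightarrow>
     (\<exists>\<sigma>. (\<forall>as' bs'. \<sigma> as' bs' \<in> A <+> B) \<and>
          (\<forall>as' bs'. play A B \<sigma> as bs k as' bs' \<longrightarrow> \<not> local_iso \<tau> ar \<pi>\<^sub>A as' \<pi>\<^sub>B bs'))"

end

theory Submission
  imports Defs
begin

text \<open>
  By induction on the formula, a formula of rank \<open>m\<close> whose values differ with one of them below \<open>k\<close>
  lets Spoiler win within \<open>k * m\<close> rounds. The connectives need no moves. At a quantifier, let the
  smaller of the two values be \<open>p < k\<close>. If it is a product \<open>p = 0\<close>, Spoiler picks an
  element with factor 0. Otherwise Spoiler picks at most \<open>k\<close> distinct elements on the side with
  the larger value, each contributing a nonzero summand (resp. a factor at least 2), whose sum (resp.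
  product) already exceeds \<open>p\<close>. Duplicator has to answer with distinct elements, whose total is at
  most \<open>p\<close>, so some answer has a smaller value than the element picked, and the induction
  hypothesis applies to this pair.
\<close>

section \<open>Finite witnesses for different sums and products\<close>

text \<open>What Spoiler needs at one quantifier: the set \<open>F\<close> is played in
  \<open>B\<close>, and \<open>h\<close> collects the answers. Only injective \<open>h\<close>
  matter, since a repeated answer to distinct elements loses immediately. The demanded pair is one
  to which the induction hypothesis applies.\<close>

definition separating :: "nat \<Rightarrow> ('a \<Rightarrow> enat) \<Rightarrow> 'a set \<Rightarrow> ('b \<Rightarrow> enat) \<Rightarrow> 'b set \<Rightarrow> bool" where
  "separating k f A g B \<longleftrightarrow>
     (\<exists>F\<subseteq>B. finite F \<and> card F \<le> k \<and>
        (\<forall>h. inj_on h F \<and> h ` F \<subseteq> A \<longrightarrow>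
           (\<exists>x\<in>F. f (h x) \<noteq> g x \<and> (f (h x) < enat k \<or> g x < enat k))))"

section \<open>Arithmetic in the extended natural numbers\<close>

lemma enat_one_le_iff: "1 \<le> (x :: enat) \<longleftrightarrow> x \<noteq> 0"
  by (metis ileI1 not_gr_zero one_eSuc not_one_le_zero)

lemma enat_two_le_iff: "2 \<le> (x :: enat) \<longleftrightarrow> x \<noteq> 0 \<and> x \<noteq> 1"
  by (cases x) (auto simp: numeral_eq_enat zero_enat_def one_enat_def)

lemma enat_mult_le_self:
  fixes x y :: enat
  assumes "y \<noteq> 0"
  shows "x \<le> x * y"
  using mult_left_mono[of 1 y x] assms by (simp add: enat_one_le_iff)

text \<open>If both products are nonzero, each bounds its own factors, so the side below
  \<open>k\<close> has both factors below \<open>k\<close>. If one product is 0, the other is not,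
  so some factor vanishes on one side only, and 0 is below \<open>k\<close>.\<close>

lemma enat_mult_differ:
  fixes x y x' y' :: enat
  assumes ne: "x * y \<noteq> x' * y'" and less: "x * y < enat k \<or> x' * y' < enat k" and k: "k \<ge> 1"
  shows "(x \<noteq> x' \<and> (x < enat k \<or> x' < enat k)) \<or> (y \<noteq> y' \<and> (y < enat k \<or> y' < enat k))"
proof (cases "x * y = 0 \<or> x' * y' = 0")
  \<comment> \<open>A product 0 does not bound both factors.\<close>
  case True
  have "0 < enat k" using k by (simp add: zero_enat_def)
  moreover have "(x = 0 \<and> x' \<noteq> 0) \<or> (x \<noteq> 0 \<and> x' = 0) \<or> (y = 0 \<and> y' \<noteq> 0) \<or> (y \<noteq> 0 \<and> y' = 0)"
    using True ne by auto
  ultimately show ?thesis by auto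
next
  case False
  then have "x \<le> x * y" "y \<le> x * y" "x' \<le> x' * y'" "y' \<le> x' * y'"
    using enat_mult_le_self[of y x] enat_mult_le_self[of x y]
      enat_mult_le_self[of y' x'] enat_mult_le_self[of x' y']
    by (auto simp: mult.commute)
  then have "(x < enat k \<and> y < enat k) \<or> (x' < enat k \<and> y' < enat k)"
    using less by (meson order_le_less_trans)
  then show ?thesis using ne by auto
qed

lemma enat_prod_mono:
  fixes f g :: "'i \<Rightarrow> enat"
  assumes "\<And>i. i \<in> I \<Longrightarrow> f i \<le> g i"
  shows "prod f I \<le> prod g I"
  using assms by (induction I rule: infinite_finite_induct) (auto intro: mult_mono)

lemma sum_le_nsum: "finite F \<Longrightarrow> F \<subseteq> A \<Longrightarrow> sum f F \<le> nsum f A"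
  unfolding nsum_def by (rule SUP_upper) auto

text \<open>A nonzero value excludes factors 0, so \<open>nprod\<close> is the supremum. With a
  factor 0, a subproduct avoiding it could exceed the value 0.\<close>

lemma prod_le_nprod:
  assumes "nprod f A \<noteq> 0" "finite F" "F \<subseteq> A"
  shows "prod f F \<le> nprod f A"
proof -
  have "nprod f A = (SUP F \<in> {F. finite F \<and> F \<subseteq> A}. prod f F)"
    using assms(1) by (simp add: nprod_def split: if_splits)
  then show ?thesis using assms(2,3) by (auto intro: SUP_upper)
qed

section \<open>Extracting at most \<open>k\<close> separating elements\<close>

lemma separating_nsum:
  assumes less: "nsum f A < nsum g B" and "nsum f A < enat k"
  shows "separating k f A g B"
proof -
  obtain F where F: "finite F" "F \<subseteq> B" "nsum f A < sum g F"
    using less unfolding nsum_def[of g] less_SUP_iff by auto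
  \<comment> \<open>Without the summands 0, each remaining one contributes at least 1, so any
    \<open>k\<close> of them already sum to at least \<open>k\<close>.\<close>
  define G where "G = {x\<in>F. g x \<noteq> 0}"
  have "sum g G = sum g F"
    unfolding G_def using F(1) by (intro sum.mono_neutral_left) auto
  with F have G: "finite G" "G \<subseteq> B" "nsum f A < sum g G" "\<forall>x\<in>G. g x \<noteq> 0"
    by (auto simp: G_def)
  obtain H where H: "H \<subseteq> G" "card H \<le> k" "nsum f A < sum g H"
  proof (cases "card G \<le> k")
    case True
    then show thesis using that G by blast
  next
    case False
    then obtain H where H: "H \<subseteq> G" "card H = k"
      by (metis nat_le_linear obtain_subset_with_card_n)
    have "(\<Sum>x\<in>H. 1) \<le> sum g H"
      using H G(4) by (intro sum_mono) (auto simp: enat_one_le_iff)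
    then have "enat k \<le> sum g H" using H by (simp add: of_nat_eq_enat)
    then show thesis using that H assms(2) by (meson order.refl order_less_le_trans)
  qed
  have "\<exists>x\<in>H. f (h x) \<noteq> g x \<and> (f (h x) < enat k \<or> g x < enat k)"
    if h: "inj_on h H" "h ` H \<subseteq> A" for h
  proof -
    have fin: "finite H" using H(1) G(1) finite_subset by blast
    \<comment> \<open>Injectivity makes the total of the answers a genuine partial sum of
      \<open>f\<close>.\<close>
    have "(\<Sum>x\<in>H. f (h x)) = sum f (h ` H)"
      using h(1) by (simp add: sum.reindex)
    also have "\<dots> \<le> nsum f A" using fin h(2) by (intro sum_le_nsum) auto
    finally have "(\<Sum>x\<in>H. f (h x)) < sum g H" using H(3) by (rule order_le_less_trans)
    then obtain x where x: "x \<in> H" "f (h x) < g x"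
      by (meson not_le sum_mono)
    \<comment> \<open>A single answer is itself a partial sum and inherits the bound
      \<open>k\<close>.\<close>
    have "f (h x) \<le> nsum f A"
      using sum_le_nsum[of "{h x}" A f] x(1) h(2) by auto
    then show ?thesis using x assms(2) by (metis order_le_less_trans order_less_irrefl)
  qed
  then show ?thesis
    unfolding separating_def using H G by (meson finite_subset order_trans)
qed

text \<open>The multiplicative analogue: factors 1 are dropped instead of summands 0, and
  \<open>k\<close> factors of at least 2 multiply to at least \<open>2 ^ k\<close>, which exceeds
  \<open>k\<close>. The assumption \<open>nz\<close> lets \<open>nprod f A\<close> bound its finite
  subproducts.\<close>

lemma separating_nprod:
  assumes less: "nprod f A < nprod g B" and "nprod f A < enat k" and nz: "nprod f A \<noteq> 0"
  shows "separating k f A g B"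
proof -
  have nz': "nprod g B \<noteq> 0" using less by auto
  then have g0: "g x \<noteq> 0" if "x \<in> B" for x
    using that by (auto simp: nprod_def split: if_splits)
  have "nprod g B = (SUP F \<in> {F. finite F \<and> F \<subseteq> B}. prod g F)"
    using nz' by (simp add: nprod_def split: if_splits)
  then obtain F where F: "finite F" "F \<subseteq> B" "nprod f A < prod g F"
    using less by (auto simp: less_SUP_iff)
  define G where "G = {x\<in>F. g x \<noteq> 1}"
  have "prod g G = prod g F"
    unfolding G_def using F(1) by (intro prod.mono_neutral_left) auto
  with F have G: "finite G" "G \<subseteq> B" "nprod f A < prod g G" "\<forall>x\<in>G. 2 \<le> g x"
    using g0 by (auto simp: G_def enat_two_le_iff)
  obtain H where H: "H \<subseteq> G" "card H \<le> k" "nprod f A < prod g H"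
  proof (cases "card G \<le> k")
    case True
    then show thesis using that G by blast
  next
    case False
    then obtain H where H: "H \<subseteq> G" "card H = k"
      by (metis nat_le_linear obtain_subset_with_card_n)
    have "enat k \<le> of_nat (2 ^ k)"
      by (simp only: of_nat_eq_enat enat_ord_simps less_exp less_imp_le)
    also have "of_nat (2 ^ k) = (\<Prod>x\<in>H. (2 :: enat))" using H by simp
    also have "\<dots> \<le> prod g H"
      using H G(4) by (intro enat_prod_mono) auto
    finally show thesis using that H assms(2) by (meson order.refl order_less_le_trans)
  qed
  have "\<exists>x\<in>H. f (h x) \<noteq> g x \<and> (f (h x) < enat k \<or> g x < enat k)"
    if h: "inj_on h H" "h ` H \<subseteq> A" for h
  proof -
    have fin: "finite H" using H(1) G(1) finite_subset by blast
    have "(\<Prod>x\<in>H. f (h x)) = prod f (h ` H)"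
      using h(1) by (simp add: prod.reindex)
    also have "\<dots> \<le> nprod f A" using fin h(2) nz by (intro prod_le_nprod) auto
    finally have "(\<Prod>x\<in>H. f (h x)) < prod g H" using H(3) by (rule order_le_less_trans)
    then obtain x where x: "x \<in> H" "f (h x) < g x"
      by (meson not_le enat_prod_mono)
    have "f (h x) \<le> nprod f A"
      using prod_le_nprod[OF nz, of "{h x}"] x(1) h(2) by auto
    then show ?thesis using x assms(2) by (metis order_le_less_trans order_less_irrefl)
  qed
  then show ?thesis
    unfolding separating_def using H G by (meson finite_subset order_trans)
qed

text \<open>One element suffices, on the side where the product vanishes: a factor 0 there meets
  only nonzero factors on the other side.\<close>

lemma separating_nprod_zero:
  assumes "nprod f A = 0" "nprod g B \<noteq> 0" "k \<ge> 1"
  shows "separating k g B f A"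
proof -
  have g0: "g x \<noteq> 0" if "x \<in> B" for x
    using that assms(2) by (auto simp: nprod_def split: if_splits)
  \<comment> \<open>The empty subproduct is 1, so the supremum is never 0 and the value 0 must come
    from a factor 0.\<close>
  have "(SUP F \<in> {F. finite F \<and> F \<subseteq> A}. prod f F) \<ge> prod f {}"
    by (rule SUP_upper) auto
  then obtain c where c: "c \<in> A" "f c = 0"
    using assms(1) by (auto simp: nprod_def split: if_splits)
  show ?thesis
    unfolding separating_def
    by (rule exI[of _ "{c}"]) (use c g0 assms(3) in \<open>auto simp: zero_enat_def\<close>)
qed

lemma separating_nsum_cases:
  assumes "nsum f A \<noteq> nsum g B" and "nsum f A < enat k \<or> nsum g B < enat k"
  shows "separating k f A g B \<or> separating k g B f A"
  using assms separating_nsum[of f A g B k] separating_nsum[of g B f A k]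
  by (metis linorder_neqE order_less_trans)

lemma separating_nprod_cases:
  assumes "nprod f A \<noteq> nprod g B" and "nprod f A < enat k \<or> nprod g B < enat k" and "k \<ge> 1"
  shows "separating k f A g B \<or> separating k g B f A"
proof (cases "nprod f A = 0 \<or> nprod g B = 0")
  case True
  then show ?thesis
    using assms(1,3) separating_nprod_zero[of f A g B k] separating_nprod_zero[of g B f A k]
    by metis
next
  case False
  then show ?thesis
    using assms(1,2) separating_nprod[of f A g B k] separating_nprod[of g B f A k]
    by (metis linorder_neqE order_less_trans)
qed

section \<open>The game\<close>

text \<open>Winning by backward induction on the number of rounds left, without mentioning a
  strategy; \<open>spoiler_wins_if_forces\<close> recovers one.\<close>

primrec spoiler_forces ::
  "'r set \<Rightarrow> ('r \<Rightarrow> nat) \<Rightarrow> 'a set \<Rightarrow> ('r, 'a) interp \<Rightarrow> 'b set \<Rightarrow> ('r, 'b) interp \<Rightarrow>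
   nat \<Rightarrow> 'a list \<Rightarrow> 'b list \<Rightarrow> bool" where
  "spoiler_forces \<tau> ar A \<pi>\<^sub>A B \<pi>\<^sub>B 0 as bs \<longleftrightarrow> \<not> local_iso \<tau> ar \<pi>\<^sub>A as \<pi>\<^sub>B bs"
| "spoiler_forces \<tau> ar A \<pi>\<^sub>A B \<pi>\<^sub>B (Suc j) as bs \<longleftrightarrow>
     (\<exists>c\<in>A. \<forall>d\<in>B. spoiler_forces \<tau> ar A \<pi>\<^sub>A B \<pi>\<^sub>B j (as @ [c]) (bs @ [d])) \<or>
     (\<exists>d\<in>B. \<forall>c\<in>A. spoiler_forces \<tau> ar A \<pi>\<^sub>A B \<pi>\<^sub>B j (as @ [c]) (bs @ [d]))"

lemma local_iso_commute:
  "local_iso \<tau> ar \<pi>\<^sub>A as \<pi>\<^sub>B bs \<longleftrightarrow> local_iso \<tau> ar \<pi>\<^sub>B bs \<pi>\<^sub>A as"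
  unfolding local_iso_def by (simp add: eq_commute cong: conj_cong)

lemma spoiler_forces_commute:
  "spoiler_forces \<tau> ar A \<pi>\<^sub>A B \<pi>\<^sub>B j as bs \<longleftrightarrow> spoiler_forces \<tau> ar B \<pi>\<^sub>B A \<pi>\<^sub>A j bs as"
  by (induction j arbitrary: as bs) (simp_all add: local_iso_commute[of _ _ \<pi>\<^sub>A] disj_commute)

text \<open>Both conditions concern positions, and appending leaves the old positions unchanged.
  Contrapositively, a violation is permanent.\<close>

lemma local_iso_prefix:
  assumes "local_iso \<tau> ar \<pi>\<^sub>A (as @ cs) \<pi>\<^sub>B (bs @ ds)" and "length cs = length ds"
  shows "local_iso \<tau> ar \<pi>\<^sub>A as \<pi>\<^sub>B bs"
proof -
  have len: "length as = length bs" using assms by (simp add: local_iso_def)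
  have eq: "as ! i = as ! j \<longleftrightarrow> bs ! i = bs ! j" if "i < length as" "j < length as" for i j
  proof -
    have "i < length (as @ cs)" "j < length (as @ cs)" using that by auto
    then have "(as @ cs) ! i = (as @ cs) ! j \<longleftrightarrow> (bs @ ds) ! i = (bs @ ds) ! j"
      using assms(1) unfolding local_iso_def by blast
    then show ?thesis using that len by (simp add: nth_append)
  qed
  have lit: "\<pi>\<^sub>A (map_lit ((!) as) L) = \<pi>\<^sub>B (map_lit ((!) bs) L)"
    if "wf_lit \<tau> ar L" and L: "set_lit L \<subseteq> {..<length as}" for L
  proof -
    have "set_lit L \<subseteq> {..<length (as @ cs)}" using L by auto
    then have "\<pi>\<^sub>A (map_lit ((!) (as @ cs)) L) = \<pi>\<^sub>B (map_lit ((!) (bs @ ds)) L)"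
      using assms(1) that(1) unfolding local_iso_def by blast
    moreover have "map_lit ((!) (as @ cs)) L = map_lit ((!) as) L"
      using L by (intro lit.map_cong) (auto simp: nth_append)
    moreover have "map_lit ((!) (bs @ ds)) L = map_lit ((!) bs) L"
      using L len by (intro lit.map_cong) (auto simp: nth_append)
    ultimately show ?thesis by simp
  qed
  show ?thesis using len eq lit by (simp add: local_iso_def)
qed

lemma spoiler_forces_not_local_iso:
  assumes "A \<noteq> {}" and "B \<noteq> {}" and "\<not> local_iso \<tau> ar \<pi>\<^sub>A as \<pi>\<^sub>B bs"
  shows "spoiler_forces \<tau> ar A \<pi>\<^sub>A B \<pi>\<^sub>B j as bs"
  using assms(3)
proof (induction j arbitrary: as bs)
  case (Suc j)
  have "\<not> local_iso \<tau> ar \<pi>\<^sub>A (as @ [c]) \<pi>\<^sub>B (bs @ [d])" for c d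
    using local_iso_prefix[of \<tau> ar \<pi>\<^sub>A as "[c]" \<pi>\<^sub>B bs "[d]"] Suc.prems by auto
  then show ?case using Suc.IH assms(1,2) by auto
qed simp

text \<open>Surplus rounds are harmless because a violation persists. This pads a quantifier step in
  which fewer than \<open>k\<close> elements are played.\<close>

lemma spoiler_forces_mono:
  assumes "A \<noteq> {}" and "B \<noteq> {}" and "spoiler_forces \<tau> ar A \<pi>\<^sub>A B \<pi>\<^sub>B i as bs" and "i \<le> j"
  shows "spoiler_forces \<tau> ar A \<pi>\<^sub>A B \<pi>\<^sub>B j as bs"
  using assms(3,4)
proof (induction i arbitrary: j as bs)
  case 0
  then show ?case using spoiler_forces_not_local_iso[OF assms(1,2)] by simp
next
  case (Suc i)
  then obtain j' where "j = Suc j'" "i \<le> j'" by (cases j) auto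
  then show ?case using Suc.prems(1) Suc.IH by fastforce
qed

section \<open>Playing a finite set on one side\<close>

text \<open>Spoiler plays the fixed list \<open>ds\<close> one element per round, ignoring the
  answers, which are collected in \<open>cs\<close>.\<close>

lemma spoiler_forces_pick_list:
  assumes "set ds \<subseteq> B"
    and "\<And>cs. length cs = length ds \<Longrightarrow> set cs \<subseteq> A \<Longrightarrow>
           spoiler_forces \<tau> ar A \<pi>\<^sub>A B \<pi>\<^sub>B r (as @ cs) (bs @ ds)"
  shows "spoiler_forces \<tau> ar A \<pi>\<^sub>A B \<pi>\<^sub>B (length ds + r) as bs"
  using assms
proof (induction ds arbitrary: as bs)
  case Nil
  then show ?case by simp
next
  case (Cons d ds)
  have "spoiler_forces \<tau> ar A \<pi>\<^sub>A B \<pi>\<^sub>B (length ds + r) (as @ [c]) (bs @ [d])" if "c \<in> A" for c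
  proof (rule Cons.IH)
    show "set ds \<subseteq> B" using Cons.prems(1) by simp
    show "spoiler_forces \<tau> ar A \<pi>\<^sub>A B \<pi>\<^sub>B r ((as @ [c]) @ cs) ((bs @ [d]) @ ds)"
      if "length cs = length ds" "set cs \<subseteq> A" for cs
      using Cons.prems(2)[of "c # cs"] that \<open>c \<in> A\<close> by simp
  qed
  then have "\<exists>d\<in>B. \<forall>c\<in>A. spoiler_forces \<tau> ar A \<pi>\<^sub>A B \<pi>\<^sub>B (length ds + r) (as @ [c]) (bs @ [d])"
    using Cons.prems(1) by auto
  then show ?case by simp
qed

lemma local_iso_distinct_suffix:
  assumes "local_iso \<tau> ar \<pi>\<^sub>A (as @ cs) \<pi>\<^sub>B (bs @ ds)" and "length cs = length ds" and "distinct ds"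
  shows "distinct cs"
  unfolding distinct_conv_nth
proof (intro allI impI)
  fix i j assume ij: "i < length cs" "j < length cs" "i \<noteq> j"
  have len: "length as = length bs" using assms by (simp add: local_iso_def)
  have "length as + i < length (as @ cs)" "length as + j < length (as @ cs)" using ij by auto
  then have "(as @ cs) ! (length as + i) = (as @ cs) ! (length as + j) \<longleftrightarrow>
      (bs @ ds) ! (length as + i) = (bs @ ds) ! (length as + j)"
    using assms(1) unfolding local_iso_def by blast
  then have "cs ! i = cs ! j \<longleftrightarrow> ds ! i = ds ! j"
    using len by (simp add: nth_append)
  then show "cs ! i \<noteq> cs ! j" using ij assms(2,3) by (simp add: nth_eq_iff_index_eq)
qed

text \<open>Spoiler plays an enumeration of the separating set. Repeated answers break the equality
  pattern; distinct ones form an injective map, so some round \<open>i\<close> yields a pair to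
  which \<open>win\<close> applies.\<close>

lemma spoiler_forces_separating:
  assumes ne: "A \<noteq> {}" "B \<noteq> {}" and sep: "separating k f A g B"
    and win: "\<And>cs ds i. length cs = length ds \<Longrightarrow> i < length ds \<Longrightarrow> f (cs ! i) \<noteq> g (ds ! i) \<Longrightarrow>
           f (cs ! i) < enat k \<or> g (ds ! i) < enat k \<Longrightarrow>
           spoiler_forces \<tau> ar A \<pi>\<^sub>A B \<pi>\<^sub>B r (as @ cs) (bs @ ds)"
  shows "spoiler_forces \<tau> ar A \<pi>\<^sub>A B \<pi>\<^sub>B (k + r) as bs"
proof -
  obtain F where F: "F \<subseteq> B" "finite F" "card F \<le> k"
    and sepF: "\<And>h. inj_on h F \<Longrightarrow> h ` F \<subseteq> A \<Longrightarrow>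
            \<exists>x\<in>F. f (h x) \<noteq> g x \<and> (f (h x) < enat k \<or> g x < enat k)"
    using sep unfolding separating_def by blast
  obtain ds where ds: "distinct ds" "set ds = F"
    using finite_distinct_list[OF F(2)] by blast
  have "spoiler_forces \<tau> ar A \<pi>\<^sub>A B \<pi>\<^sub>B r (as @ cs) (bs @ ds)"
    if cs: "length cs = length ds" "set cs \<subseteq> A" for cs
  proof (cases "distinct cs")
    case False
    then have "\<not> local_iso \<tau> ar \<pi>\<^sub>A (as @ cs) \<pi>\<^sub>B (bs @ ds)"
      using local_iso_distinct_suffix cs(1) ds(1) by blast
    then show ?thesis by (rule spoiler_forces_not_local_iso[OF ne])
  next
    case True
    \<comment> \<open>The map from each played element to its answer, well defined because
      \<open>ds\<close> is distinct.\<close>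
    define h where "h d = the (map_of (zip ds cs) d)" for d
    have h: "h (ds ! i) = cs ! i" if "i < length ds" for i
      using that cs(1) ds(1) by (simp add: h_def map_of_zip_nth)
    have "inj_on h F"
      unfolding ds(2)[symmetric] inj_on_def
      using True h cs(1) by (metis in_set_conv_nth nth_eq_iff_index_eq)
    moreover have "h ` F \<subseteq> A"
      unfolding ds(2)[symmetric] using h cs by (fastforce simp: in_set_conv_nth)
    ultimately obtain i where "i < length ds" "f (h (ds ! i)) \<noteq> g (ds ! i)"
      "f (h (ds ! i)) < enat k \<or> g (ds ! i) < enat k"
      using sepF ds(2) by (metis in_set_conv_nth)
    then show ?thesis using win cs(1) h by metis
  qed
  then have "spoiler_forces \<tau> ar A \<pi>\<^sub>A B \<pi>\<^sub>B (length ds + r) as bs"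
    using F(1) ds(2) by (intro spoiler_forces_pick_list) auto
  then show ?thesis
    using F(3) ds by (auto intro: spoiler_forces_mono[OF ne] simp: distinct_card[symmetric])
qed

text \<open>The separating set may lie on either side; exchanging the two universes reduces the
  second case to the first.\<close>

lemma spoiler_forces_separating':
  assumes ne: "A \<noteq> {}" "B \<noteq> {}" and sep: "separating k f A g B \<or> separating k g B f A"
    and win: "\<And>cs ds i. length cs = length ds \<Longrightarrow> i < length ds \<Longrightarrow> f (cs ! i) \<noteq> g (ds ! i) \<Longrightarrow>
           f (cs ! i) < enat k \<or> g (ds ! i) < enat k \<Longrightarrow>
           spoiler_forces \<tau> ar A \<pi>\<^sub>A B \<pi>\<^sub>B r (as @ cs) (bs @ ds)"
  shows "spoiler_forces \<tau> ar A \<pi>\<^sub>A B \<pi>\<^sub>B (k + r) as bs"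
  using sep
proof
  assume "separating k f A g B"
  then show ?thesis using win by (rule spoiler_forces_separating[OF ne])
next
  assume "separating k g B f A"
  then have "spoiler_forces \<tau> ar B \<pi>\<^sub>B A \<pi>\<^sub>A (k + r) bs as"
    by (rule spoiler_forces_separating[OF ne(2,1)])
      (subst spoiler_forces_commute, rule win, auto)
  then show ?thesis by (subst spoiler_forces_commute)
qed

section \<open>From forced wins to strategies\<close>

lemma spoiler_wins_if_forces:
  assumes "A \<noteq> {}" and "B \<noteq> {}" and forces: "spoiler_forces \<tau> ar A \<pi>\<^sub>A B \<pi>\<^sub>B K as bs"
  shows "spoiler_wins \<tau> ar A B K \<pi>\<^sub>A as \<pi>\<^sub>B bs"
proof -
  let ?W = "spoiler_forces \<tau> ar A \<pi>\<^sub>A B \<pi>\<^sub>B"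
  \<comment> \<open>A good move is legal and keeps the win with \<open>j\<close> further rounds,
    whatever the answer.\<close>
  define good where "good j as' bs' mv \<longleftrightarrow> mv \<in> A <+> B \<and>
      (case mv of Inl c \<Rightarrow> \<forall>d\<in>B. ?W j (as' @ [c]) (bs' @ [d])
                | Inr d \<Rightarrow> \<forall>c\<in>A. ?W j (as' @ [c]) (bs' @ [d]))" for j as' bs' mv
  have ex_good: "\<exists>mv. good j as' bs' mv" if "?W (Suc j) as' bs'" for j as' bs'
    using that unfolding good_def by (fastforce split: sum.splits)
  \<comment> \<open>The number of rounds left is read off the length of the position.\<close>
  define \<sigma> where "\<sigma> as' bs' =
      (let j = K - Suc (length as' - length as) in
       if \<exists>mv. good j as' bs' mv then SOME mv. good j as' bs' mv else Inl (SOME c. c \<in> A))"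
    for as' bs'
  have \<sigma>_good: "good (K - Suc (length as' - length as)) as' bs' (\<sigma> as' bs')"
    if "\<exists>mv. good (K - Suc (length as' - length as)) as' bs' mv" for as' bs'
    using that someI_ex[OF that] by (simp add: \<sigma>_def Let_def)
  \<comment> \<open>A strategy must be legal at every position, even an unreachable one; the default
    move in \<open>A\<close> covers positions without a good move.\<close>
  have \<sigma>_in: "\<sigma> as' bs' \<in> A <+> B" for as' bs'
  proof (cases "\<exists>mv. good (K - Suc (length as' - length as)) as' bs' mv")
    case True
    then show ?thesis using \<sigma>_good good_def by blast
  next
    case False
    then show ?thesis using assms(1) by (auto simp: \<sigma>_def Let_def some_in_eq)
  qed
  \<comment> \<open>The guard \<open>j \<le> K\<close> keeps the subtraction \<open>K - j\<close>
    from being truncated. The length equation lets \<open>\<sigma>\<close> recover the round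
    number.\<close>
  have invariant: "length as' = length as + j \<and> (j \<le> K \<longrightarrow> ?W (K - j) as' bs')"
    if "play A B \<sigma> as bs j as' bs'" for j as' bs'
    using that
  proof induction
    case start
    then show ?case using forces by simp
  next
    case (pick_A j as' bs' c d)
    have "?W (K - Suc j) (as' @ [c]) (bs' @ [d])" if "Suc j \<le> K"
    proof -
      have "?W (Suc (K - Suc j)) as' bs'" using pick_A.IH that by (simp add: Suc_diff_Suc)
      then have "good (K - Suc j) as' bs' (\<sigma> as' bs')"
        using \<sigma>_good[of as' bs'] ex_good pick_A.IH by simp
      then show ?thesis using pick_A.hyps by (simp add: good_def)
    qed
    then show ?case using pick_A.IH by simp
  next
    case (pick_B j as' bs' d c)
    have "?W (K - Suc j) (as' @ [c]) (bs' @ [d])" if "Suc j \<le> K"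
    proof -
      have "?W (Suc (K - Suc j)) as' bs'" using pick_B.IH that by (simp add: Suc_diff_Suc)
      then have "good (K - Suc j) as' bs' (\<sigma> as' bs')"
        using \<sigma>_good[of as' bs'] ex_good pick_B.IH by simp
      then show ?thesis using pick_B.hyps by (simp add: good_def)
    qed
    then show ?case using pick_B.IH by simp
  qed
  show ?thesis
    unfolding spoiler_wins_def
  proof (intro exI[of _ \<sigma>] conjI allI impI)
    show "\<sigma> as' bs' \<in> A <+> B" for as' bs' by (rule \<sigma>_in)
    show "\<not> local_iso \<tau> ar \<pi>\<^sub>A as' \<pi>\<^sub>B bs'" if "play A B \<sigma> as bs K as' bs'" for as' bs'
      using invariant[OF that] by simp
  qed
qed

section \<open>From distinguishing formulae to winning strategies\<close>

text \<open>\<open>local_iso\<close> speaks of literals over positions, so each variable is renamed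
  to a position holding its value in both tuples.\<close>

lemma local_iso_literal:
  assumes iso: "local_iso \<tau> ar \<pi>\<^sub>A as \<pi>\<^sub>B bs" and wf: "wf_lit \<tau> ar L"
    and cover: "\<forall>x\<in>set_lit L. \<exists>i<length as. s x = as ! i \<and> t x = bs ! i"
  shows "\<pi>\<^sub>A (map_lit s L) = \<pi>\<^sub>B (map_lit t L)"
proof -
  obtain p where p: "\<forall>x\<in>set_lit L. p x < length as \<and> s x = as ! p x \<and> t x = bs ! p x"
    using cover by metis
  have "wf_lit \<tau> ar (map_lit p L)" using wf by (cases L) auto
  moreover have "set_lit (map_lit p L) \<subseteq> {..<length as}" using p by (auto simp: lit.set_map)
  ultimately have "\<pi>\<^sub>A (map_lit ((!) as) (map_lit p L)) = \<pi>\<^sub>B (map_lit ((!) bs) (map_lit p L))"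
    using iso unfolding local_iso_def by blast
  moreover have "map_lit ((!) as) (map_lit p L) = map_lit s L"
    using p by (simp add: lit.map_comp cong: lit.map_cong)
  moreover have "map_lit ((!) bs) (map_lit p L) = map_lit t L"
    using p by (simp add: lit.map_comp cong: lit.map_cong)
  ultimately show ?thesis by simp
qed

text \<open>The step shared by both quantifiers: \<open>f\<close> and \<open>g\<close> stand for
  evaluation of the body, \<open>V\<close> for its free variables. They take whole assignments
  because the induction hypothesis is applied to updated ones.\<close>

lemma spoiler_forces_quantifier:
  assumes ne: "A \<noteq> {}" "B \<noteq> {}"
    and cover: "\<forall>y\<in>V - {x}. \<exists>i<length as. i < length bs \<and> s y = as ! i \<and> t y = bs ! i"
    and sep: "separating k (\<lambda>c. f (s(x := c))) A (\<lambda>d. g (t(x := d))) B \<or>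
      separating k (\<lambda>d. g (t(x := d))) B (\<lambda>c. f (s(x := c))) A"
    and win: "\<And>as' bs' s' t'.
      \<forall>y\<in>V. \<exists>i<length as'. i < length bs' \<and> s' y = as' ! i \<and> t' y = bs' ! i \<Longrightarrow>
      f s' \<noteq> g t' \<Longrightarrow> f s' < enat k \<or> g t' < enat k \<Longrightarrow>
      spoiler_forces \<tau> ar A \<pi>\<^sub>A B \<pi>\<^sub>B r as' bs'"
  shows "spoiler_forces \<tau> ar A \<pi>\<^sub>A B \<pi>\<^sub>B (k + r) as bs"
proof (cases "length as = length bs")
  case False
  then have "\<not> local_iso \<tau> ar \<pi>\<^sub>A as \<pi>\<^sub>B bs" by (simp add: local_iso_def)
  then show ?thesis by (rule spoiler_forces_not_local_iso[OF ne])
next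
  \<comment> \<open>Equal lengths put the \<open>i\<close>-th appended elements
    \<open>cs ! i\<close> and \<open>ds ! i\<close> at the same index, the new location of
    \<open>x\<close>.\<close>
  case len: True
  show ?thesis
  proof (rule spoiler_forces_separating'[OF ne sep], rule win)
    fix cs :: "'a list" and ds :: "'b list" and i
    assume i: "length cs = length ds" "i < length ds"
    show "\<forall>y\<in>V. \<exists>j<length (as @ cs). j < length (bs @ ds) \<and>
        (s(x := cs ! i)) y = (as @ cs) ! j \<and> (t(x := ds ! i)) y = (bs @ ds) ! j"
    proof
      fix y assume "y \<in> V"
      show "\<exists>j<length (as @ cs). j < length (bs @ ds) \<and>
        (s(x := cs ! i)) y = (as @ cs) ! j \<and> (t(x := ds ! i)) y = (bs @ ds) ! j"
      proof (cases "y = x")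
        case True
        then show ?thesis using i len
          by (intro exI[of _ "length as + i"]) (simp add: nth_append)
      next
        case False
        then obtain j where "j < length as" "j < length bs" "s y = as ! j" "t y = bs ! j"
          using cover \<open>y \<in> V\<close> by blast
        then show ?thesis using False by (intro exI[of _ j]) (simp add: nth_append)
      qed
    qed
  qed
qed

text \<open>The assignments are tied to the tuples only by a common position for each free variable.
  The tuples may thus hold further elements, as they do after a quantifier, where several elements
  are appended but only one pair is assigned.\<close>

lemma spoiler_forces_formula:
  assumes ne: "A \<noteq> {}" "B \<noteq> {}" and k: "k \<ge> 1"
  shows "\<lbrakk>wf_fml \<tau> ar \<phi>; qr \<phi> \<le> m;
     \<forall>x\<in>fv \<phi>. \<exists>i<length as. i < length bs \<and> s x = as ! i \<and> t x = bs ! i;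
     eval A \<pi>\<^sub>A s \<phi> \<noteq> eval B \<pi>\<^sub>B t \<phi>;
     eval A \<pi>\<^sub>A s \<phi> < enat k \<or> eval B \<pi>\<^sub>B t \<phi> < enat k\<rbrakk> \<Longrightarrow>
     spoiler_forces \<tau> ar A \<pi>\<^sub>A B \<pi>\<^sub>B (k * m) as bs"
proof (induction \<phi> arbitrary: m as bs s t)
  case (Eq x y)
  then obtain i j where "i < length as" "j < length as" "s x = as ! i" "t x = bs ! i"
    "s y = as ! j" "t y = bs ! j" by auto
  moreover have "(s x = s y) \<noteq> (t x = t y)" using Eq.prems(4) by (auto split: if_splits)
  ultimately have "\<not> local_iso \<tau> ar \<pi>\<^sub>A as \<pi>\<^sub>B bs"
    unfolding local_iso_def by metis
  then show ?case by (rule spoiler_forces_not_local_iso[OF ne])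
next
  case (Neq x y)
  then obtain i j where "i < length as" "j < length as" "s x = as ! i" "t x = bs ! i"
    "s y = as ! j" "t y = bs ! j" by auto
  moreover have "(s x = s y) \<noteq> (t x = t y)" using Neq.prems(4) by (auto split: if_splits)
  ultimately have "\<not> local_iso \<tau> ar \<pi>\<^sub>A as \<pi>\<^sub>B bs"
    unfolding local_iso_def by metis
  then show ?case by (rule spoiler_forces_not_local_iso[OF ne])
next
  case (Lit L)
  then have "\<not> local_iso \<tau> ar \<pi>\<^sub>A as \<pi>\<^sub>B bs"
    using local_iso_literal[of \<tau> ar \<pi>\<^sub>A as \<pi>\<^sub>B bs L s t]
    by (metis eval.simps(3) fv.simps(3) wf_fml.simps(3))
  then show ?case by (rule spoiler_forces_not_local_iso[OF ne])
next
  case (Or \<phi> \<psi>)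
  \<comment> \<open>A sum below \<open>k\<close> bounds both summands, so whichever disjunct differs
    inherits the bound.\<close>
  have le: "x < enat k \<and> y < enat k" if "x + y < enat k" for x y :: enat
    using that by (cases x; cases y) auto
  consider "eval A \<pi>\<^sub>A s \<phi> \<noteq> eval B \<pi>\<^sub>B t \<phi>" | "eval A \<pi>\<^sub>A s \<psi> \<noteq> eval B \<pi>\<^sub>B t \<psi>"
    using Or.prems(4) by (metis eval.simps(4))
  then show ?case
  proof cases
    case 1
    show ?thesis
    proof (rule Or.IH(1)[OF _ _ _ 1])
      show "\<forall>x\<in>fv \<phi>. \<exists>i<length as. i < length bs \<and> s x = as ! i \<and> t x = bs ! i"
        using Or.prems(3) by simp
      show "eval A \<pi>\<^sub>A s \<phi> < enat k \<or> eval B \<pi>\<^sub>B t \<phi> < enat k"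
        using Or.prems(5) le by (metis eval.simps(4))
    qed (use Or.prems(1,2) in simp_all)
  next
    case 2
    show ?thesis
    proof (rule Or.IH(2)[OF _ _ _ 2])
      show "\<forall>x\<in>fv \<psi>. \<exists>i<length as. i < length bs \<and> s x = as ! i \<and> t x = bs ! i"
        using Or.prems(3) by simp
      show "eval A \<pi>\<^sub>A s \<psi> < enat k \<or> eval B \<pi>\<^sub>B t \<psi> < enat k"
        using Or.prems(5) le by (metis eval.simps(4))
    qed (use Or.prems(1,2) in simp_all)
  qed
next
  case (And \<phi> \<psi>)
  let ?x = "eval A \<pi>\<^sub>A s \<phi>" and ?y = "eval A \<pi>\<^sub>A s \<psi>"
  let ?x' = "eval B \<pi>\<^sub>B t \<phi>" and ?y' = "eval B \<pi>\<^sub>B t \<psi>"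
  consider "?x \<noteq> ?x'" "?x < enat k \<or> ?x' < enat k" | "?y \<noteq> ?y'" "?y < enat k \<or> ?y' < enat k"
    using enat_mult_differ[of ?x ?y ?x' ?y' k] And.prems(4,5) k by auto
  then show ?case
  proof cases
    case 1
    show ?thesis
    proof (rule And.IH(1)[OF _ _ _ 1])
      show "\<forall>x\<in>fv \<phi>. \<exists>i<length as. i < length bs \<and> s x = as ! i \<and> t x = bs ! i"
        using And.prems(3) by simp
    qed (use And.prems(1,2) in simp_all)
  next
    case 2
    show ?thesis
    proof (rule And.IH(2)[OF _ _ _ 2])
      show "\<forall>x\<in>fv \<psi>. \<exists>i<length as. i < length bs \<and> s x = as ! i \<and> t x = bs ! i"
        using And.prems(3) by simp
    qed (use And.prems(1,2) in simp_all)
  qed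
next
  case (Ex x \<phi>)
  obtain m' where m: "m = Suc m'" "qr \<phi> \<le> m'"
    using Ex.prems(2) by (cases m) auto
  \<comment> \<open>The quantifier costs \<open>k\<close> rounds and its body \<open>k * m'\<close>,
    together \<open>k * m\<close>.\<close>
  have "spoiler_forces \<tau> ar A \<pi>\<^sub>A B \<pi>\<^sub>B (k + k * m') as bs"
  proof (rule spoiler_forces_quantifier[where f = "\<lambda>s. eval A \<pi>\<^sub>A s \<phi>" and g = "\<lambda>t. eval B \<pi>\<^sub>B t \<phi>",
        OF ne])
    show "\<forall>y\<in>fv \<phi> - {x}. \<exists>i<length as. i < length bs \<and> s y = as ! i \<and> t y = bs ! i"
      using Ex.prems(3) by simp
    show "separating k (\<lambda>c. eval A \<pi>\<^sub>A (s(x := c)) \<phi>) A (\<lambda>d. eval B \<pi>\<^sub>B (t(x := d)) \<phi>) B \<or>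
        separating k (\<lambda>d. eval B \<pi>\<^sub>B (t(x := d)) \<phi>) B (\<lambda>c. eval A \<pi>\<^sub>A (s(x := c)) \<phi>) A"
      using Ex.prems(4,5) by (intro separating_nsum_cases) simp_all
    show "spoiler_forces \<tau> ar A \<pi>\<^sub>A B \<pi>\<^sub>B (k * m') as' bs'"
      if cover: "\<forall>y\<in>fv \<phi>. \<exists>i<length as'. i < length bs' \<and> s' y = as' ! i \<and> t' y = bs' ! i"
        and "eval A \<pi>\<^sub>A s' \<phi> \<noteq> eval B \<pi>\<^sub>B t' \<phi>"
        and "eval A \<pi>\<^sub>A s' \<phi> < enat k \<or> eval B \<pi>\<^sub>B t' \<phi> < enat k" for as' bs' s' t'
      using Ex.IH[OF _ m(2) that] Ex.prems(1) by simp
  qed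
  then show ?case using m by simp
next
  case (All x \<phi>)
  obtain m' where m: "m = Suc m'" "qr \<phi> \<le> m'"
    using All.prems(2) by (cases m) auto
  have "spoiler_forces \<tau> ar A \<pi>\<^sub>A B \<pi>\<^sub>B (k + k * m') as bs"
  proof (rule spoiler_forces_quantifier[where f = "\<lambda>s. eval A \<pi>\<^sub>A s \<phi>" and g = "\<lambda>t. eval B \<pi>\<^sub>B t \<phi>",
        OF ne])
    show "\<forall>y\<in>fv \<phi> - {x}. \<exists>i<length as. i < length bs \<and> s y = as ! i \<and> t y = bs ! i"
      using All.prems(3) by simp
    show "separating k (\<lambda>c. eval A \<pi>\<^sub>A (s(x := c)) \<phi>) A (\<lambda>d. eval B \<pi>\<^sub>B (t(x := d)) \<phi>) B \<or>
        separating k (\<lambda>d. eval B \<pi>\<^sub>B (t(x := d)) \<phi>) B (\<lambda>c. eval A \<pi>\<^sub>A (s(x := c)) \<phi>) A"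
      using All.prems(4,5) k by (intro separating_nprod_cases) simp_all
    show "spoiler_forces \<tau> ar A \<pi>\<^sub>A B \<pi>\<^sub>B (k * m') as' bs'"
      if cover: "\<forall>y\<in>fv \<phi>. \<exists>i<length as'. i < length bs' \<and> s' y = as' ! i \<and> t' y = bs' ! i"
        and "eval A \<pi>\<^sub>A s' \<phi> \<noteq> eval B \<pi>\<^sub>B t' \<phi>"
        and "eval A \<pi>\<^sub>A s' \<phi> < enat k \<or> eval B \<pi>\<^sub>B t' \<phi> < enat k" for as' bs' s' t'
      using All.IH[OF _ m(2) that] All.prems(1) by simp
  qed
  then show ?case using m by simp
qed

theorem theorem4p2:
  fixes \<tau> :: "'r set" and ar :: "'r \<Rightarrow> nat"
    and A :: "'a set" and B :: "'b set"
    and \<pi>\<^sub>A :: "('r, 'a) interp" and \<pi>\<^sub>B :: "('r, 'b) interp"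
    and as :: "'a list" and bs :: "'b list" and xs :: "nat list"
    and n k m :: nat
  assumes "finite \<tau>"
    and "A \<noteq> {}" and "B \<noteq> {}"
    and "length as = n" and "set as \<subseteq> A"
    and "length bs = n" and "set bs \<subseteq> B"
    and "length xs = n" and "distinct xs"
    and "k \<ge> 1"
    and "\<exists>\<phi>. wf_fml \<tau> ar \<phi> \<and> fv \<phi> \<subseteq> set xs \<and> qr \<phi> \<le> m \<and>
           eval A \<pi>\<^sub>A (assign xs as) \<phi> \<noteq> eval B \<pi>\<^sub>B (assign xs bs) \<phi> \<and>
           (eval A \<pi>\<^sub>A (assign xs as) \<phi> < enat k \<or> eval B \<pi>\<^sub>B (assign xs bs) \<phi> < enat k)"
  shows "spoiler_wins \<tau> ar A B (k * m) \<pi>\<^sub>A as \<pi>\<^sub>B bs"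
proof (rule spoiler_wins_if_forces[OF assms(2,3)])
  obtain \<phi> where \<phi>: "wf_fml \<tau> ar \<phi>" "fv \<phi> \<subseteq> set xs" "qr \<phi> \<le> m"
    "eval A \<pi>\<^sub>A (assign xs as) \<phi> \<noteq> eval B \<pi>\<^sub>B (assign xs bs) \<phi>"
    "eval A \<pi>\<^sub>A (assign xs as) \<phi> < enat k \<or> eval B \<pi>\<^sub>B (assign xs bs) \<phi> < enat k"
    using assms(11) by blast
  \<comment> \<open>Variable \<open>xs ! i\<close> is located at index \<open>i\<close> of both
    tuples; distinctness of \<open>xs\<close> makes the lookup in \<open>assign\<close> return that
    entry.\<close>
  have cover: "\<forall>x\<in>fv \<phi>. \<exists>i<length as. i < length bs \<and>
      assign xs as x = as ! i \<and> assign xs bs x = bs ! i"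
  proof
    fix x assume "x \<in> fv \<phi>"
    then have "x \<in> set xs" using \<phi>(2) by (rule rev_subsetD)
    then obtain i where i: "i < n" "x = xs ! i"
      using assms(8) by (auto simp: in_set_conv_nth)
    then have "assign xs as x = as ! i \<and> assign xs bs x = bs ! i"
      using assms(4,6,8,9) by (simp add: assign_def map_of_zip_nth)
    with i(1) show "\<exists>i<length as. i < length bs \<and>
        assign xs as x = as ! i \<and> assign xs bs x = bs ! i"
      using assms(4,6) by (intro exI[of _ i]) simp
  qed
  show "spoiler_forces \<tau> ar A \<pi>\<^sub>A B \<pi>\<^sub>B (k * m) as bs"
    by (rule spoiler_forces_formula[OF assms(2,3,10) \<phi>(1,3) cover \<phi>(4,5)])
qed

end
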